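(* Let $(Z_i, R_i)$, $i \in \mathbb{N}$, be a disjoint collection of minimal systems. For all minimal systems $(X,T)$, all $\varepsilon > 0$, and all sufficiently large $i$ (depending on the systems $(Z_i,R_i)$, on $(X,T)$, and on $\varepsilon$), all joinings $(J, T \times R_i)$ of $(X,T)$ and $(Z_i, R_i)$ satisfy: for all $z \in Z_i$, the set $\pi_1(J \cap (X \times \{z\}))$ is $\varepsilon$-dense in $X$.
   Context: $\mathbb{N}$ is the set of positive integers. A (topological dynamical) system $(X,T)$ is a nonempty compact metric space $X$ together with a continuous map $T : X \to X$. A subsystem of $(X,T)$ is $(Y,T)$ with $Y \subseteq X$ nonempty, closed, and $TY \subseteq Y$. A system is minimal if its only subsystem is itself. A collection of minimal systems $(X_i,T_i)$, $i \in I$, is disjoint if the product system $(\prod_i X_i, \prod_i T_i)$ is minimal (equivalently, the product of every finite subcollection is minimal). A joining of $(X,T)$ and $(Y,S)$ is a subsystem $(J, T \times S)$ of the product system $(X \times Y, T \times S)$ whose projections to $X$ and to $Y$ are all of $X$ and all of $Y$, respectively. $\pi_1 : X \times Z_i \to X$ is the projection to the first coordinate. A subset of $X$ is $\varepsilon$-dense if it meets every open ball of radius $\varepsilon$ in $X$. *)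

theory Defs
  imports "HOL-Analysis.Analysis"
begin

text \<open>
  Metric spaces are elements of the library type \<open>'a metric\<close>, so that the spaces of a
  family may have different carriers (\<open>mspace\<close>) inside one ambient type.  Subsystems and
  minimality involve the topology only; they are stated for topologies so that they also
  apply to product systems.
\<close>

definition dyn_system :: "'a metric \<Rightarrow> ('a \<Rightarrow> 'a) \<Rightarrow> bool" where
  "dyn_system X T \<longleftrightarrow>
     mspace X \<noteq> {} \<and> compact_space (mtopology_of X) \<and>
     continuous_map (mtopology_of X) (mtopology_of X) T"

definition subsystem :: "'a topology \<Rightarrow> ('a \<Rightarrow> 'a) \<Rightarrow> 'a set \<Rightarrow> bool" where
  "subsystem X T Y \<longleftrightarrow> Y \<noteq> {} \<and> closedin X Y \<and> T ` Y \<subseteq> Y"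

definition minimal :: "'a topology \<Rightarrow> ('a \<Rightarrow> 'a) \<Rightarrow> bool" where
  "minimal X T \<longleftrightarrow> (\<forall>Y. subsystem X T Y \<longrightarrow> Y = topspace X)"

definition minimal_system :: "'a metric \<Rightarrow> ('a \<Rightarrow> 'a) \<Rightarrow> bool" where
  "minimal_system X T \<longleftrightarrow> dyn_system X T \<and> minimal (mtopology_of X) T"

text \<open>
  Points of the product over \<open>I\<close> are the functions that are \<open>undefined\<close> outside \<open>I\<close>
  (\<open>PiE\<close>), hence the restricted abstraction in the product map.
\<close>

definition disjoint_systems :: "'i set \<Rightarrow> ('i \<Rightarrow> 'a metric) \<Rightarrow> ('i \<Rightarrow> 'a \<Rightarrow> 'a) \<Rightarrow> bool" where
  "disjoint_systems I Z R \<longleftrightarrow>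
     (\<forall>i\<in>I. minimal_system (Z i) (R i)) \<and>
     minimal (product_topology (\<lambda>i. mtopology_of (Z i)) I) (\<lambda>z. \<lambda>i\<in>I. R i (z i))"

definition joining ::
  "'a metric \<Rightarrow> ('a \<Rightarrow> 'a) \<Rightarrow> 'b metric \<Rightarrow> ('b \<Rightarrow> 'b) \<Rightarrow> ('a \<times> 'b) set \<Rightarrow> bool" where
  "joining X T Y S J \<longleftrightarrow>
     subsystem (prod_topology (mtopology_of X) (mtopology_of Y)) (map_prod T S) J \<and>
     fst ` J = mspace X \<and> snd ` J = mspace Y"

definition eps_dense :: "'a metric \<Rightarrow> real \<Rightarrow> 'a set \<Rightarrow> bool" where
  "eps_dense X \<epsilon> A \<longleftrightarrow>
     A \<subseteq> mspace X \<and>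
     (\<forall>x\<in>mspace X. A \<inter> mball_of X x \<epsilon> \<noteq> {})"

end

theory Submission
  imports Defs
begin

text \<open>
  Suppose that the fibres fail to be \<open>\<epsilon>\<close>-dense for infinitely many \<open>i\<close>.  Compactness of \<open>X\<close>
  makes one closed ball \<open>C\<close> be missed by a fibre for infinitely many \<open>i\<close>; fix for each such \<open>i\<close>
  a joining \<open>J\<^sub>i\<close> with a fibre that misses \<open>C\<close>.  As \<open>J\<^sub>i\<close> is closed and \<open>C\<close> is compact, all the
  fibres over some nonempty open \<open>V\<^sub>i \<subseteq> Z\<^sub>i\<close> miss \<open>C\<close>.  Now fix \<open>x \<in> X\<close> and partners \<open>w\<^sub>i\<close> with
  \<open>(x, w\<^sub>i) \<in> J\<^sub>i\<close>.  Since \<open>J\<^sub>i\<close> is invariant, \<open>x\<close> is outside \<open>C\<close> at each time at which \<open>w\<^sub>i\<close>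
  visits \<open>V\<^sub>i\<close>.

  These constraints conflict.  By minimality of \<open>X\<close>, the point \<open>x\<close> visits the interior of \<open>C\<close>
  with gaps bounded by some \<open>L\<close> (\<open>minimal_bounded_gaps\<close>).  By disjointness the visits of the
  \<open>w\<^sub>i\<close> to the \<open>V\<^sub>i\<close> can be scheduled at will: taking \<open>L\<close> different indices and
  numbering them by \<open>k < L\<close>, there is an \<open>n\<close> such that the partner of \<open>x\<close> with number \<open>k\<close>
  visits its target at time \<open>n + k\<close>, for all \<open>k < L\<close> at once
  (\<open>disjoint_systems_scheduled_visits\<close>).  Then \<open>x\<close> stays
  outside \<open>C\<close> during the \<open>L\<close> consecutive times \<open>n, \<dots>, n + L - 1\<close>, a contradiction.
\<close>

section \<open>Visits to open sets in minimal systems\<close>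

lemma continuous_map_funpow:
  assumes "continuous_map X X T"
  shows "continuous_map X X (T ^^ n)"
proof (induction n)
  case 0
  then show ?case by (simp add: id_def)
next
  case (Suc n)
  then show ?case using continuous_map_compose[OF Suc assms] by (simp add: o_def)
qed

text \<open>
  The points whose orbits never enter \<open>U\<close> form a closed invariant set, which is not the whole
  space.
\<close>
lemma minimal_visits_open:
  assumes min: "minimal X T" and cont: "continuous_map X X T"
    and U: "openin X U" "U \<noteq> {}" and x: "x \<in> topspace X"
  shows "\<exists>n. (T ^^ n) x \<in> U"
proof (rule ccontr)
  assume never: "\<nexists>n. (T ^^ n) x \<in> U"
  define Y where "Y = (\<Inter>n. {y \<in> topspace X. (T ^^ n) y \<in> topspace X - U})"
  have "closedin X Y"
    unfolding Y_def using U(1) continuous_map_funpow[OF cont]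
    by (intro closedin_INT closedin_continuous_map_preimage) auto
  moreover have "T ` Y \<subseteq> Y"
  proof
    fix y assume "y \<in> T ` Y"
    then obtain a where a: "a \<in> Y" "y = T a" by blast
    have "(T ^^ n) y = (T ^^ Suc n) a" for n
      using a(2) by (simp add: funpow_swap1)
    moreover have "(T ^^ n) a \<in> topspace X - U" for n
      using a(1) unfolding Y_def by blast
    moreover have "y \<in> topspace X"
      using a cont unfolding Y_def continuous_map_def by auto
    ultimately show "y \<in> Y" unfolding Y_def by (simp del: funpow.simps)
  qed
  moreover have "x \<in> Y"
    using never x continuous_map_funpow[OF cont]
    unfolding Y_def continuous_map_def by auto
  ultimately have "Y = topspace X"
    using min unfolding minimal_def subsystem_def by blast
  moreover obtain u where "u \<in> U" using U(2) by blast
  ultimately have "u \<in> Y" using openin_subset[OF U(1)] by blast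
  then have "(T ^^ 0) u \<notin> U" unfolding Y_def by blast
  with \<open>u \<in> U\<close> show False by simp
qed

text \<open>
  The preimages of \<open>U\<close> under the iterates of \<open>T\<close> cover the space, so finitely many of them do.
\<close>
lemma minimal_bounded_gaps:
  assumes min: "minimal X T" and cont: "continuous_map X X T" and cpt: "compact_space X"
    and U: "openin X U" "U \<noteq> {}"
  obtains L :: nat where "\<And>x. x \<in> topspace X \<Longrightarrow> \<exists>n<L. (T ^^ n) x \<in> U"
proof -
  define P where "P n = {x \<in> topspace X. (T ^^ n) x \<in> U}" for n
  have "openin X (P n)" for n
    unfolding P_def
    using openin_continuous_map_preimage[OF continuous_map_funpow[OF cont] U(1)] .
  moreover have "topspace X \<subseteq> \<Union> (range P)"
    using minimal_visits_open[OF min cont U] unfolding P_def by blast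
  ultimately obtain \<F> where \<F>: "finite \<F>" "\<F> \<subseteq> range P" "topspace X \<subseteq> \<Union> \<F>"
    using cpt unfolding compact_space_alt by (metis (no_types, lifting) imageE)
  then obtain M where M: "finite M" "\<F> = P ` M"
    by (meson finite_subset_image)
  obtain L where L: "\<And>n. n \<in> M \<Longrightarrow> n < L"
    using M(1) finite_nat_bounded by blast
  show ?thesis
  proof (rule that)
    fix x assume "x \<in> topspace X"
    then obtain n where "n \<in> M" "x \<in> P n" using \<F>(3) M(2) by blast
    then show "\<exists>n<L. (T ^^ n) x \<in> U" using L unfolding P_def by blast
  qed
qed

text \<open>The image of the space is a subsystem, because it is compact and hence closed.\<close>
lemma minimal_funpow_surj:
  assumes min: "minimal X T" and cont: "continuous_map X X T" and cpt: "compact_space X"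
    and haus: "Hausdorff_space X"
  shows "(T ^^ n) ` topspace X = topspace X"
proof (induction n)
  case 0
  then show ?case by simp
next
  case (Suc n)
  have sub: "T ` topspace X \<subseteq> topspace X"
    using cont by (rule continuous_map_image_subset_topspace)
  have "T ` topspace X = topspace X"
  proof (cases "topspace X = {}")
    case True
    then show ?thesis by simp
  next
    case False
    have "closedin X (T ` topspace X)"
      using cpt haus image_compactin[OF _ cont]
      by (simp add: compact_space_def compactin_imp_closedin)
    then have "subsystem X T (T ` topspace X)"
      using False sub unfolding subsystem_def by blast
    then show ?thesis using min unfolding minimal_def by blast
  qed
  then show ?case using Suc by (simp add: image_comp[symmetric] del: o_apply)
qed

section \<open>Scheduling visits in disjoint systems\<close>

lemma minimal_systemD:
  assumes "minimal_system X T"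
  shows "minimal (mtopology_of X) T" "continuous_map (mtopology_of X) (mtopology_of X) T"
    "compact_space (mtopology_of X)" "mspace X \<noteq> {}"
  using assms unfolding minimal_system_def dyn_system_def by auto

lemma Hausdorff_space_mtopology_of: "Hausdorff_space (mtopology_of X)"
  unfolding mtopology_of_def by (simp add: Metric_space.Hausdorff_space_mtopology)

lemma funpow_product_map:
  fixes R :: "'i \<Rightarrow> 'a \<Rightarrow> 'a"
  assumes "i \<in> I"
  shows "((\<lambda>z. \<lambda>i\<in>I. R i (z i)) ^^ n) z i = (R i ^^ n) (z i)"
  using assms by (induction n) auto

text \<open>
  The delays \<open>k i\<close> cost nothing: a visit to \<open>V i\<close> delayed by \<open>k i\<close> is a visit to the preimage of
  \<open>V i\<close> under the \<open>k i\<close>-th iterate of \<open>R i\<close>, and this preimage is nonempty because the map of a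
  minimal system is onto.  The claim is thus a visit of the product system to an open box.
\<close>
lemma disjoint_systems_scheduled_visits:
  assumes disj: "disjoint_systems I Z R"
    and F: "finite F" "F \<subseteq> I"
    and V: "\<And>i. i \<in> F \<Longrightarrow> openin (mtopology_of (Z i)) (V i) \<and> V i \<noteq> {}"
    and w: "\<And>i. i \<in> F \<Longrightarrow> w i \<in> mspace (Z i)"
  obtains n where "\<And>i. i \<in> F \<Longrightarrow> (R i ^^ (k i + n)) (w i) \<in> V i"
proof -
  let ?Q = "product_topology (\<lambda>i. mtopology_of (Z i)) I"
  let ?S = "\<lambda>z. \<lambda>i\<in>I. R i (z i)"
  have ms: "minimal_system (Z i) (R i)" if "i \<in> I" for i
    using disj that unfolding disjoint_systems_def by blast
  have contR: "continuous_map (mtopology_of (Z i)) (mtopology_of (Z i)) (R i)" if "i \<in> I" for i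
    using minimal_systemD(2)[OF ms[OF that]] .
  have min: "minimal ?Q ?S"
    using disj unfolding disjoint_systems_def by blast
  have "continuous_map ?Q (mtopology_of (Z i)) (\<lambda>z. R i (z i))" if "i \<in> I" for i
    using continuous_map_compose[OF
        continuous_map_product_projection[OF that, where X = "\<lambda>i. mtopology_of (Z i)"] contR[OF that]]
    by (simp add: o_def)
  then have cont: "continuous_map ?Q ?Q ?S"
    by (subst continuous_map_componentwise) (simp, blast intro: restrict_extensional)
  define W where "W i =
      (if i \<in> F then {z \<in> mspace (Z i). (R i ^^ k i) z \<in> V i} else mspace (Z i))" for i
  have W_open: "openin (mtopology_of (Z i)) (W i)" if "i \<in> I" for i
    using V[of i]
      openin_continuous_map_preimage[OF continuous_map_funpow[OF contR[OF that]], of "V i" "k i"]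
      openin_topspace[of "mtopology_of (Z i)"]
    unfolding W_def by auto
  have W_ne: "W i \<noteq> {}" if "i \<in> I" for i
  proof (cases "i \<in> F")
    case True
    have "(R i ^^ k i) ` mspace (Z i) = mspace (Z i)"
      using minimal_funpow_surj[OF minimal_systemD(1-3)[OF ms[OF that]] Hausdorff_space_mtopology_of]
      by simp
    moreover have "V i \<noteq> {}" "V i \<subseteq> mspace (Z i)"
      using V[OF True] openin_subset by fastforce+
    ultimately have "\<exists>z\<in>mspace (Z i). (R i ^^ k i) z \<in> V i"
      by (metis all_not_in_conv imageE subsetD)
    then show ?thesis using True unfolding W_def by auto
  next
    case False
    then show ?thesis using minimal_systemD(4)[OF ms[OF that]] unfolding W_def by simp
  qed
  have "{i \<in> I. W i \<noteq> topspace (mtopology_of (Z i))} \<subseteq> F"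
    unfolding W_def by auto
  then have "finite {i \<in> I. W i \<noteq> topspace (mtopology_of (Z i))}"
    using F(1) by (rule finite_subset)
  then have open_box: "openin ?Q (PiE I W)"
    using W_open unfolding openin_PiE_gen by blast
  have box_ne: "PiE I W \<noteq> {}"
    using W_ne by (simp add: PiE_eq_empty_iff)
  define p where "p = (\<lambda>i\<in>I. if i \<in> F then w i else SOME z. z \<in> mspace (Z i))"
  have "p \<in> topspace ?Q"
    using w minimal_systemD(4)[OF ms] unfolding p_def by (auto simp: some_in_eq)
  then obtain n where n: "(?S ^^ n) p \<in> PiE I W"
    using minimal_visits_open[OF min cont open_box box_ne] by blast
  show ?thesis
  proof (rule that)
    fix i assume i: "i \<in> F"
    then have "i \<in> I" using F(2) by blast
    then have "(R i ^^ n) (p i) \<in> W i"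
      using n funpow_product_map[where i = i and I = I and R = R and n = n and z = p]
      by (metis PiE_mem)
    then show "(R i ^^ (k i + n)) (w i) \<in> V i"
      using i \<open>i \<in> I\<close> unfolding W_def p_def by (simp add: funpow_add)
  qed
qed

section \<open>Fibres of joinings\<close>

lemma joining_funpow:
  assumes "joining X T Y S J" "(x, y) \<in> J"
  shows "((T ^^ n) x, (S ^^ n) y) \<in> J"
proof (induction n)
  case 0
  then show ?case using assms(2) by simp
next
  case (Suc n)
  have "map_prod T S ` J \<subseteq> J"
    using assms(1) unfolding joining_def subsystem_def by blast
  then show ?case using Suc by force
qed

text \<open>
  The points whose fibre meets \<open>C\<close> are the projection of a compact set, so they form a closed
  set.
\<close>
lemma joining_fibre_misses_open:
  assumes J: "joining X T Y S J"
    and X: "compact_space (mtopology_of X)" and Y: "compact_space (mtopology_of Y)"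
    and C: "closedin (mtopology_of X) C"
  shows "openin (mtopology_of Y) {y \<in> mspace Y. J \<inter> (C \<times> {y}) = {}}"
proof -
  let ?P = "prod_topology (mtopology_of X) (mtopology_of Y)"
  let ?K = "J \<inter> (C \<times> mspace Y)"
  have "closedin ?P J"
    using J unfolding joining_def subsystem_def by blast
  moreover have "closedin ?P (C \<times> mspace Y)"
    using C closedin_topspace[of "mtopology_of Y"] by (simp add: closedin_prod_Times_iff)
  ultimately have "closedin ?P ?K" by blast
  moreover have "compact_space ?P"
    using X Y by (simp add: compact_space_prod_topology)
  ultimately have "compactin ?P ?K"
    by (rule closedin_compact_space[rotated])
  then have "closedin (mtopology_of Y) (snd ` ?K)"
    using image_compactin[OF _ continuous_map_snd]
    by (blast intro: compactin_imp_closedin[OF Hausdorff_space_mtopology_of])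
  then have "openin (mtopology_of Y) (mspace Y - snd ` ?K)"
    using openin_diff[OF openin_topspace] by fastforce
  moreover have "mspace Y - snd ` ?K = {y \<in> mspace Y. J \<inter> (C \<times> {y}) = {}}"
    by force
  ultimately show ?thesis by simp
qed

section \<open>Joinings with a fibre that misses an open set\<close>

text \<open>
  Each exceptional index forbids \<open>C\<close> at some times along the orbit of \<open>x\<close>.  With as many
  exceptional indices as the gap bound for the visits to \<open>U\<close>, these times can be arranged to fill
  an interval that is too long to be free of visits to \<open>U\<close>.  The set \<open>C\<close> is closed so that missing
  it is an open condition on the fibre; \<open>U\<close> is open so that minimality forces visits to it.
\<close>
lemma finite_joinings_missing_closed_set:
  assumes disj: "disjoint_systems I Z R" and min: "minimal_system X T"
    and C: "closedin (mtopology_of X) C"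
    and U: "openin (mtopology_of X) U" "U \<noteq> {}" "U \<subseteq> C"
  shows "finite {i \<in> I. \<exists>J z. joining X T (Z i) (R i) J \<and> z \<in> mspace (Z i) \<and> J \<inter> (C \<times> {z}) = {}}"
    (is "finite ?B")
proof (rule ccontr)
  assume inf: "infinite ?B"
  obtain L where L: "\<And>x. x \<in> mspace X \<Longrightarrow> \<exists>n<L. (T ^^ n) x \<in> U"
    using minimal_bounded_gaps[OF minimal_systemD(1-3)[OF min] U(1,2)] by force
  obtain F where F: "F \<subseteq> ?B" "finite F" "card F = L"
    using infinite_arbitrarily_large[OF inf] by blast
  obtain k where k: "bij_betw k F {0..<L}"
    using ex_bij_betw_finite_nat[OF F(2)] F(3) by blast
  have "\<forall>i\<in>F. \<exists>J z. joining X T (Z i) (R i) J \<and> z \<in> mspace (Z i) \<and> J \<inter> (C \<times> {z}) = {}"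
    using F(1) by blast
  then obtain J z where J: "\<And>i. i \<in> F \<Longrightarrow> joining X T (Z i) (R i) (J i)"
    and z: "\<And>i. i \<in> F \<Longrightarrow> z i \<in> mspace (Z i) \<and> J i \<inter> (C \<times> {z i}) = {}"
    by metis
  define V where "V i = {y \<in> mspace (Z i). J i \<inter> (C \<times> {y}) = {}}" for i
  have V: "openin (mtopology_of (Z i)) (V i) \<and> V i \<noteq> {}" if "i \<in> F" for i
  proof
    have "minimal_system (Z i) (R i)"
      using disj F(1) that unfolding disjoint_systems_def by blast
    then show "openin (mtopology_of (Z i)) (V i)"
      unfolding V_def
      by (rule joining_fibre_misses_open[OF J[OF that] minimal_systemD(3)[OF min] minimal_systemD(3) C])
    show "V i \<noteq> {}" using z[OF that] unfolding V_def by blast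
  qed
  obtain x where x: "x \<in> mspace X" using minimal_systemD(4)[OF min] by blast
  have "\<exists>w. w \<in> mspace (Z i) \<and> (x, w) \<in> J i" if "i \<in> F" for i
    using J[OF that] x unfolding joining_def by force
  then obtain w where w: "\<And>i. i \<in> F \<Longrightarrow> w i \<in> mspace (Z i)" "\<And>i. i \<in> F \<Longrightarrow> (x, w i) \<in> J i"
    by metis
  obtain n where n: "\<And>i. i \<in> F \<Longrightarrow> (R i ^^ (k i + n)) (w i) \<in> V i"
    using disjoint_systems_scheduled_visits[OF disj F(2) _ V w(1)] F(1) by blast
  have "(T ^^ n) x \<in> mspace X"
    using x continuous_map_funpow[OF minimal_systemD(2)[OF min]]
    unfolding continuous_map_def by auto
  then obtain m where m: "m < L" "(T ^^ m) ((T ^^ n) x) \<in> U" using L by blast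
  then obtain i where i: "i \<in> F" "k i = m"
    using k unfolding bij_betw_def by (metis atLeast0LessThan imageE lessThan_iff)
  have "(T ^^ (k i + n)) x \<in> C"
    using m(2) i(2) U(3) by (auto simp: funpow_add)
  moreover have "((T ^^ (k i + n)) x, (R i ^^ (k i + n)) (w i)) \<in> J i"
    using joining_funpow[OF J w(2)] i(1) by blast
  ultimately show False using n[OF i(1)] unfolding V_def by blast
qed

lemma compact_metric_finite_centres:
  assumes "compact_space (mtopology_of X)" "0 < r"
  obtains K where "finite K" "K \<subseteq> mspace X" "mspace X \<subseteq> (\<Union>c\<in>K. mball_of X c r)"
proof -
  interpret Metric_space "mspace X" "mdist X" by simp
  have "mtotally_bounded (mspace X)"
    using assms(1) compactin_imp_mtotally_bounded
    by (simp add: compact_space_def mtopology_of_def)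
  then show ?thesis
    using assms(2) that unfolding mtotally_bounded_def mball_of_def by blast
qed

theorem theorem4p3:
  fixes Z :: "nat \<Rightarrow> 'z metric" and R :: "nat \<Rightarrow> 'z \<Rightarrow> 'z"
  assumes "disjoint_systems {1..} Z R"
  shows "\<forall>(X :: 'x metric) T. minimal_system X T \<longrightarrow>
    (\<forall>\<epsilon>>0. \<exists>N\<ge>1. \<forall>i\<ge>N. \<forall>J. joining X T (Z i) (R i) J \<longrightarrow>
      (\<forall>z\<in>mspace (Z i). eps_dense X \<epsilon> (fst ` (J \<inter> (mspace X \<times> {z})))))"
proof (intro allI impI)
  fix X :: "'x metric" and T and \<epsilon> :: real
  assume min: "minimal_system X T" and \<epsilon>: "0 < \<epsilon>"
  interpret Metric_space "mspace X" "mdist X" by simp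
  obtain K where K: "finite K" "K \<subseteq> mspace X" "mspace X \<subseteq> (\<Union>c\<in>K. mball c (\<epsilon>/2))"
    using compact_metric_finite_centres[OF minimal_systemD(3)[OF min], of "\<epsilon>/2"] \<epsilon>
    unfolding mball_of_def by auto
  \<comment> \<open>A ball of radius \<open>\<epsilon>\<close> contains the closed \<open>\<epsilon>/2\<close>-ball around any \<open>c\<close> at distance less than
    \<open>\<epsilon>/2\<close> from its centre, so it suffices to hit the finitely many closed balls around \<open>K\<close>.\<close>
  define B where "B c = {i \<in> {1..}. \<exists>J z. joining X T (Z i) (R i) J \<and> z \<in> mspace (Z i) \<and>
      J \<inter> (mcball c (\<epsilon>/2) \<times> {z}) = {}}" for c
  have "finite (B c)" if "c \<in> K" for c
    unfolding B_def
  proof (rule finite_joinings_missing_closed_set[OF assms min])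
    show "closedin (mtopology_of X) (mcball c (\<epsilon>/2))" "openin (mtopology_of X) (mball c (\<epsilon>/2))"
      unfolding mtopology_of_def by auto
    have "c \<in> mball c (\<epsilon>/2)" using that K(2) \<epsilon> by auto
    then show "mball c (\<epsilon>/2) \<noteq> {}" by blast
  qed auto
  then have "finite (\<Union>c\<in>K. B c)" using K(1) by blast
  then obtain N where "(\<Union>c\<in>K. B c) \<subseteq> {..<N}"
    using finite_nat_bounded by meson
  then have N: "i < N" if "c \<in> K" "i \<in> B c" for c i
    using that by blast
  have "eps_dense X \<epsilon> (fst ` (J \<inter> (mspace X \<times> {z})))"
    if i: "max N 1 \<le> i" and J: "joining X T (Z i) (R i) J" and z: "z \<in> mspace (Z i)" for i J z
    unfolding eps_dense_def
  proof (intro conjI ballI)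
    fix x assume x: "x \<in> mspace X"
    then obtain c where c: "c \<in> K" "x \<in> mball c (\<epsilon>/2)" using K(3) by blast
    have "i \<notin> B c" using N[OF c(1)] i by fastforce
    then have "J \<inter> (mcball c (\<epsilon>/2) \<times> {z}) \<noteq> {}"
      using i J z unfolding B_def by auto
    then obtain y where y: "(y, z) \<in> J" "y \<in> mcball c (\<epsilon>/2)"
      by blast
    have "mdist X x y < \<epsilon>"
      using c(2) y(2) triangle[of x c y] x commute[of x c] by auto
    then show "fst ` (J \<inter> (mspace X \<times> {z})) \<inter> mball_of X x \<epsilon> \<noteq> {}"
      using x y unfolding mball_of_def by force
  qed auto
  then show "\<exists>N\<ge>1. \<forall>i\<ge>N. \<forall>J. joining X T (Z i) (R i) J \<longrightarrow>
      (\<forall>z\<in>mspace (Z i). eps_dense X \<epsilon> (fst ` (J \<inter> (mspace X \<times> {z}))))"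
    by (intro exI[of _ "max N 1"]) auto
qed

end
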